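(* Let $E\subset\mathbb{R}^d$ be non-empty and bounded. If $\underline{\dim}_BE=\dim_{qA}E$, then $$\underline{\dim}_\theta E=\underline{\dim}_BE\quad\text{for all }\theta\in(0,1],$$ and if $\overline{\dim}_BE=\dim_{qA}E$, then $$\overline{\dim}_\theta E=\overline{\dim}_BE\quad\text{for all }\theta\in(0,1].$$
   Context: $\underline{\dim}_B$ and $\overline{\dim}_B$ denote the lower and upper box dimensions. $|U|$ denotes the diameter of a set $U$, and $B(x,R)$ the open ball with centre $x$ and radius $R$. Intermediate dimensions. For a non-empty bounded set $F\subset\mathbb{R}^d$ and $\theta\in(0,1]$, the lower $\theta$-intermediate dimension $\underline{\dim}_\theta F$ is the infimum of all $s\ge 0$ such that for all $\epsilon>0$ and all $\delta_0>0$ there exist $0<\delta\le\delta_0$ and a cover $\{U_i\}_{i\in I}$ of $F$ with $\delta^{1/\theta}\le|U_i|\le\delta$ for all $i$ and $\sum_{i}|U_i|^s\le\epsilon$. The upper $\theta$-intermediate dimension $\overline{\dim}_\theta F$ is the infimum of all $s\ge 0$ such that for all $\epsilon>0$ there exists $\delta_0>0$ such that for all $0<\delta\le\delta_0$ there is a cover $\{U_i\}_{i\in I}$ of $F$ with $\delta^{1/\theta}\le|U_i|\le\delta$ for all $i$ and $\sum_i|U_i|^s\le\epsilon$. Quasi-Assouad dimension. $N_r(F)$ is the minimum number of sets of diameter $r$ that can cover $F$. For $\alpha\in(0,1)$, the upper Assouad spectrum $\overline{\dim}_A^{\alpha}E$ is the infimum of all $s$ for which there is $C>0$ such that $N_r(B(x,R)\cap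 E)\le C(R/r)^s$ for all $0<r\le R^{1/\alpha}<R<1$ and all $x\in E$; it is non-decreasing in $\alpha$, and $\dim_{qA}E:=\lim_{\alpha\to1^-}\overline{\dim}_A^{\alpha}E$. *)

theory Defs
  imports "HOL-Analysis.Analysis"
begin

text \<open>
  All dimensions are extended reals, so that infima of sets of exponents and lower and upper
  limits always exist.

  The library's \<^const>\<open>diameter\<close> is only meaningful on bounded sets (an unbounded set gets an
  unspecified real number), so boundedness of covering sets is required explicitly.
\<close>

text \<open>
  The minimum is over a nonempty set of natural numbers whenever \<open>F\<close> is a bounded subset of a
  Euclidean space and \<open>r > 0\<close>; these are the only cases of interest.
\<close>

definition cover_num :: "real \<Rightarrow> 'a::metric_space set \<Rightarrow> nat" where
  "cover_num r F =
     Inf {card \<U> | \<U>. finite \<U> \<and> F \<subseteq> \<Union>\<U> \<and> (\<forall>U\<in>\<U>. bounded U \<and> diameter U = r)}"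

definition lower_box_dim :: "'a::metric_space set \<Rightarrow> ereal" where
  "lower_box_dim F = Liminf (at_right 0) (\<lambda>r. ereal (ln (real (cover_num r F)) / - ln r))"

definition upper_box_dim :: "'a::metric_space set \<Rightarrow> ereal" where
  "upper_box_dim F = Limsup (at_right 0) (\<lambda>r. ereal (ln (real (cover_num r F)) / - ln r))"

text \<open>
  Covers are arbitrary sets of sets. The sum is taken in \<^typ>\<open>ennreal\<close>, so that it is \<open>\<infinity>\<close> rather
  than a default value when it diverges. The convention \<open>0 powr 0 = 0\<close> plays no role, because
  the diameters of the covering sets are bounded below by \<open>\<delta> powr (1 / \<theta>) > 0\<close>.
\<close>

definition has_theta_cover ::
  "real \<Rightarrow> 'a::metric_space set \<Rightarrow> real \<Rightarrow> real \<Rightarrow> real \<Rightarrow> bool" where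
  "has_theta_cover \<theta> F s \<epsilon> \<delta> \<longleftrightarrow>
     (\<exists>\<U>. F \<subseteq> \<Union>\<U> \<and>
          (\<forall>U\<in>\<U>. bounded U \<and> \<delta> powr (1 / \<theta>) \<le> diameter U \<and> diameter U \<le> \<delta>) \<and>
          (\<Sum>\<^sub>\<infinity>U\<in>\<U>. ennreal (diameter U powr s)) \<le> ennreal \<epsilon>)"

definition lower_intermediate_dim :: "real \<Rightarrow> 'a::metric_space set \<Rightarrow> ereal" where
  "lower_intermediate_dim \<theta> F =
     Inf {ereal s | s. s \<ge> 0 \<and>
       (\<forall>\<epsilon>>0. \<forall>\<delta>\<^sub>0>0. \<exists>\<delta>. 0 < \<delta> \<and> \<delta> \<le> \<delta>\<^sub>0 \<and> has_theta_cover \<theta> F s \<epsilon> \<delta>)}"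

definition upper_intermediate_dim :: "real \<Rightarrow> 'a::metric_space set \<Rightarrow> ereal" where
  "upper_intermediate_dim \<theta> F =
     Inf {ereal s | s. s \<ge> 0 \<and>
       (\<forall>\<epsilon>>0. \<exists>\<delta>\<^sub>0>0. \<forall>\<delta>. 0 < \<delta> \<and> \<delta> \<le> \<delta>\<^sub>0 \<longrightarrow> has_theta_cover \<theta> F s \<epsilon> \<delta>)}"

definition upper_Assouad_spectrum :: "real \<Rightarrow> 'a::metric_space set \<Rightarrow> ereal" where
  "upper_Assouad_spectrum \<alpha> E =
     Inf {ereal s | s. \<exists>C>0. \<forall>r R. \<forall>x\<in>E.
       0 < r \<and> r \<le> R powr (1 / \<alpha>) \<and> R powr (1 / \<alpha>) < R \<and> R < 1 \<longrightarrow>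
       real (cover_num r (ball x R \<inter> E)) \<le> C * (R / r) powr s}"

definition quasi_Assouad_dim :: "'a::metric_space set \<Rightarrow> ereal" where
  "quasi_Assouad_dim E = Lim (at_left 1) (\<lambda>\<alpha>. upper_Assouad_spectrum \<alpha> E)"

end

theory Submission
  imports Defs
begin

text \<open>
  The inequality \<open>dim\<^sub>\<theta> E \<le> dim\<^sub>B E\<close>, in its lower and its upper form, needs nothing but the
  definitions: a cover by sets of one diameter \<open>r\<close> is admissible for \<open>\<delta> = r < 1\<close>, and its cost is
  \<open>N\<^sub>r(E) r\<^sup>s\<close>, which tends to \<open>0\<close> along scales at which \<open>N\<^sub>r(E) \<le> r powr (-s')\<close> for some \<open>s' < s\<close>.

  For the reverse inequality, let \<open>t\<close> be the common value of the box dimension and the quasi-Assouad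
  dimension, and suppose that for some \<open>s < t\<close> the set \<open>E\<close> has an admissible cover \<open>U\<^sub>i\<close> with
  \<open>\<Sum> |U\<^sub>i|\<^sup>s \<le> 1\<close> at scale \<open>\<delta>\<close>. All the sets \<open>U\<^sub>i\<close> are refined to the single
  scale \<open>r = \<delta> powr (2/\<theta>)\<close>. Since \<open>|U\<^sub>i| \<ge> \<delta> powr (1/\<theta>)\<close>, this scale satisfies \<open>r \<le> |U\<^sub>i|\<^sup>2\<close>, which is
  the range of scales controlled by the upper Assouad spectrum at \<open>\<alpha> = 1/2\<close>. The spectrum is
  monotone in \<open>\<alpha>\<close> with limit the quasi-Assouad dimension, so it is at most \<open>t\<close> at \<open>1/2\<close>, and for
  every \<open>u > t\<close> the piece \<open>U\<^sub>i \<inter> E\<close> costs at most a constant times \<open>(|U\<^sub>i| / r)\<^sup>u\<close> sets of diameter \<open>r\<close>.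
  Because \<open>|U\<^sub>i|\<^sup>u \<le> |U\<^sub>i|\<^sup>s \<delta> powr (u - s)\<close>, summation gives, up to a constant,
  \<open>N\<^sub>r(E) \<le> r powr (-u) * \<delta> powr (u - s) = r powr (-(u - (u - s) \<theta> / 2))\<close>
  (lemma \<open>cover_num_le_of_theta_cover\<close>). For \<open>u\<close> close to \<open>t\<close> this exponent is bounded by some
  \<open>v < t\<close>. So the existence of cheap covers at the scales \<open>\<delta>\<close> forces the box-counting exponent
  of \<open>E\<close> to be at most \<open>v\<close> at the corresponding scales \<open>r\<close> (lemma
  \<open>box_exponent_le_of_theta_cover\<close>). If cheap covers exist at arbitrarily small scales, the lower
  box dimension is less than \<open>t\<close>; if they exist at all small scales, the upper box dimension is
  less than \<open>t\<close>. Either contradicts the choice of \<open>t\<close>.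

  The exponents \<open>u\<close> and \<open>v\<close> are chosen as reals, which requires \<open>t\<close> to be finite. That is the
  purpose of the grid covers, which bound the upper box dimension of a bounded set.
\<close>

section \<open>Covers by sets of equal diameter\<close>

definition scale_cover :: "real \<Rightarrow> 'a::metric_space set \<Rightarrow> 'a set set \<Rightarrow> bool" where
  "scale_cover r F \<U> \<longleftrightarrow> finite \<U> \<and> F \<subseteq> \<Union>\<U> \<and> (\<forall>U\<in>\<U>. bounded U \<and> diameter U = r)"

lemma cover_num_le_card: "scale_cover r F \<U> \<Longrightarrow> cover_num r F \<le> card \<U>"
  unfolding cover_num_def scale_cover_def by (rule cInf_lower) auto

text \<open>
  Rounding each coordinate down to a multiple of \<open>h = r / (2 DIM)\<close> moves a point by at most \<open>r / 2\<close>,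
  so the closed balls of radius \<open>r / 2\<close> about the grid points cover. In a Euclidean space such balls
  have diameter exactly \<open>r\<close>, as the cover number demands.
\<close>

lemma grid_cover:
  fixes F :: "'a::euclidean_space set"
  assumes F: "F \<subseteq> cball 0 M" and M: "0 \<le> M" and r: "0 < r"
  shows "\<exists>\<U>. scale_cover r F \<U> \<and> real (card \<U>) \<le> (4 * real DIM('a) * M / r + 3) ^ DIM('a)"
proof -
  define h where "h = r / (2 * real DIM('a))"
  define m where "m = \<lceil>M / h\<rceil>"
  define p where "p f = (\<Sum>b\<in>Basis. (h * of_int (f b)) *\<^sub>R b)" for f :: "'a \<Rightarrow> int"
  define G where "G = Pi\<^sub>E (Basis :: 'a set) (\<lambda>_. {-m..m})"
  define \<U> where "\<U> = (\<lambda>f. cball (p f) (r / 2)) ` G"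
  have h: "h > 0" and hd: "real DIM('a) * h = r / 2" using r by (auto simp: h_def)
  have "0 \<le> M / h" using M h by simp
  then have m: "m \<ge> 0" unfolding m_def by linarith
  have finG: "finite G" unfolding G_def by (intro finite_PiE) auto
  have cardG: "card G = nat (2 * m + 1) ^ DIM('a)"
    unfolding G_def by (simp add: card_PiE)
  have "F \<subseteq> \<Union>\<U>"
  proof
    fix x assume "x \<in> F"
    then have x: "norm x \<le> M" using F by auto
    define f where "f = restrict (\<lambda>b. \<lfloor>(x \<bullet> b) / h\<rfloor>) (Basis :: 'a set)"
    have "f \<in> G" unfolding G_def
    proof (rule PiE_I)
      fix b :: 'a assume b: "b \<in> Basis"
      have "\<bar>x \<bullet> b\<bar> \<le> M" using Basis_le_norm[OF b, of x] x by linarith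
      then have "-(M / h) \<le> (x \<bullet> b) / h" "(x \<bullet> b) / h \<le> M / h"
        using h by (auto simp: field_simps abs_le_iff)
      then have "-m \<le> \<lfloor>(x \<bullet> b) / h\<rfloor>" "\<lfloor>(x \<bullet> b) / h\<rfloor> \<le> m"
        unfolding m_def by linarith+
      then show "f b \<in> {-m..m}" using b by (simp add: f_def)
    qed (simp add: f_def)
    have "norm (x - p f) \<le> (\<Sum>b\<in>Basis. \<bar>(x - p f) \<bullet> b\<bar>)" by (rule norm_le_l1)
    also have "\<dots> \<le> (\<Sum>b\<in>(Basis :: 'a set). h)"
    proof (rule sum_mono)
      fix b :: 'a assume b: "b \<in> Basis"
      have "(x - p f) \<bullet> b = x \<bullet> b - h * \<lfloor>(x \<bullet> b) / h\<rfloor>"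
        using b by (simp add: p_def f_def inner_diff_left)
      also have "\<dots> = h * ((x \<bullet> b) / h - \<lfloor>(x \<bullet> b) / h\<rfloor>)"
        using h by (simp add: field_simps)
      finally have eq: "(x - p f) \<bullet> b = h * ((x \<bullet> b) / h - \<lfloor>(x \<bullet> b) / h\<rfloor>)" .
      have "\<bar>(x \<bullet> b) / h - \<lfloor>(x \<bullet> b) / h\<rfloor>\<bar> \<le> 1" by linarith
      then show "\<bar>(x - p f) \<bullet> b\<bar> \<le> h"
        unfolding eq using h by (simp add: abs_mult mult_left_le)
    qed
    also have "\<dots> = r / 2" using hd by simp
    finally have "x \<in> cball (p f) (r / 2)" by (simp add: dist_norm norm_minus_commute)
    then show "x \<in> \<Union>\<U>" using \<open>f \<in> G\<close> by (auto simp: \<U>_def)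
  qed
  then have "scale_cover r F \<U>"
    unfolding scale_cover_def \<U>_def using finG r by auto
  moreover have "real (card \<U>) \<le> (4 * real DIM('a) * M / r + 3) ^ DIM('a)"
  proof -
    have "real (card \<U>) \<le> real (card G)"
      unfolding \<U>_def using card_image_le[OF finG] by simp
    also have "\<dots> = (2 * real_of_int m + 1) ^ DIM('a)" using m by (simp add: cardG)
    also have "\<dots> \<le> (4 * real DIM('a) * M / r + 3) ^ DIM('a)"
    proof (rule power_mono)
      have "real_of_int m \<le> M / h + 1" unfolding m_def by linarith
      moreover have "4 * real DIM('a) * M / r = 2 * (M / h)" using r by (simp add: h_def)
      ultimately show "2 * real_of_int m + 1 \<le> 4 * real DIM('a) * M / r + 3" by linarith
    qed (use m in auto)
    finally show ?thesis .
  qed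
  ultimately show ?thesis by blast
qed

lemma bounded_subset_cball_0:
  fixes F :: "'a::real_normed_vector set"
  assumes "bounded F"
  obtains M where "0 \<le> M" "F \<subseteq> cball 0 M"
proof -
  obtain B where "\<forall>x\<in>F. norm x \<le> B" using assms by (auto simp: bounded_iff)
  then have "F \<subseteq> cball 0 (max B 0)" by auto
  then show ?thesis using that[of "max B 0"] by simp
qed

lemma cover_num_attained:
  fixes F :: "'a::euclidean_space set"
  assumes "bounded F" "0 < r"
  obtains \<U> where "scale_cover r F \<U>" "card \<U> = cover_num r F"
proof -
  define K where "K = {card \<U> | \<U>. scale_cover r F \<U>}"
  obtain M where "0 \<le> M" "F \<subseteq> cball 0 M" by (rule bounded_subset_cball_0[OF assms(1)])
  then have "K \<noteq> {}" using grid_cover[of F M r] assms(2) by (auto simp: K_def)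
  then have "Inf K \<in> K" by (rule Inf_nat_def1)
  moreover have "Inf K = cover_num r F" by (simp add: K_def cover_num_def scale_cover_def)
  ultimately show ?thesis using that by (auto simp: K_def)
qed

lemma cover_num_ge_1:
  fixes F :: "'a::euclidean_space set"
  assumes "bounded F" "F \<noteq> {}" "0 < r"
  shows "1 \<le> cover_num r F"
proof -
  obtain \<U> where \<U>: "scale_cover r F \<U>" "card \<U> = cover_num r F"
    by (rule cover_num_attained[OF assms(1,3)])
  then have "finite \<U>" "\<U> \<noteq> {}" using assms(2) by (auto simp: scale_cover_def)
  then have "0 < card \<U>" by (simp add: card_gt_0_iff)
  then show ?thesis using \<U>(2) by simp
qed

lemma cover_num_le_sum:
  fixes F :: "'a::euclidean_space set"
  assumes "finite I" "F \<subseteq> (\<Union>i\<in>I. A i)" "\<And>i. i \<in> I \<Longrightarrow> bounded (A i)" "0 < r"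
  shows "cover_num r F \<le> (\<Sum>i\<in>I. cover_num r (A i))"
proof -
  have "\<forall>i\<in>I. \<exists>\<V>. scale_cover r (A i) \<V> \<and> card \<V> = cover_num r (A i)"
    using assms(3,4) cover_num_attained by metis
  then obtain \<V> where \<V>: "\<And>i. i \<in> I \<Longrightarrow> scale_cover r (A i) (\<V> i)"
    "\<And>i. i \<in> I \<Longrightarrow> card (\<V> i) = cover_num r (A i)" by metis
  have "F \<subseteq> \<Union> (\<Union>i\<in>I. \<V> i)"
  proof
    fix x assume "x \<in> F"
    then obtain i where "i \<in> I" "x \<in> A i" using assms(2) by blast
    moreover from this have "x \<in> \<Union> (\<V> i)" using \<V>(1)[of i] by (auto simp: scale_cover_def)
    ultimately show "x \<in> \<Union> (\<Union>i\<in>I. \<V> i)" by blast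
  qed
  then have "scale_cover r F (\<Union>i\<in>I. \<V> i)"
    using \<V>(1) assms(1) unfolding scale_cover_def by auto
  then have "cover_num r F \<le> card (\<Union>i\<in>I. \<V> i)" by (rule cover_num_le_card)
  also have "\<dots> \<le> (\<Sum>i\<in>I. card (\<V> i))" by (rule card_UN_le[OF assms(1)])
  also have "\<dots> = (\<Sum>i\<in>I. cover_num r (A i))" using \<V>(2) by simp
  finally show ?thesis .
qed

section \<open>The box-counting exponent\<close>

definition box_exponent :: "'a::metric_space set \<Rightarrow> real \<Rightarrow> real" where
  "box_exponent F r = ln (real (cover_num r F)) / - ln r"

lemma eventually_at_right_0: "0 < (c::real) \<Longrightarrow> eventually (\<lambda>r. 0 < r \<and> r < c) (at_right 0)"
  using eventually_at_right_real[of 0 c] by simp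

lemma neg_ln_at_right_0: "filterlim (\<lambda>r::real. - ln r) at_top (at_right 0)"
  using ln_at_0 by (simp add: filterlim_uminus_at_bot)

lemma box_exponent_le:
  assumes "1 \<le> cover_num r F" "0 < r" "r < 1" "0 < K"
    and "real (cover_num r F) \<le> K * r powr (- w)"
  shows "box_exponent F r \<le> w + ln K / - ln r"
proof -
  have "ln (real (cover_num r F)) \<le> ln (K * r powr (- w))"
    using assms by (intro ln_mono) auto
  also have "\<dots> = ln K - w * ln r" using assms by (simp add: ln_mult ln_powr)
  finally show ?thesis
    unfolding box_exponent_def using assms by (simp add: field_simps)
qed

lemma eventually_const_div_neg_ln_less:
  fixes c :: real assumes "0 < e"
  shows "eventually (\<lambda>r. c / - ln r < e) (at_right 0)"
proof -
  have "((\<lambda>r. c / - ln r) \<longlongrightarrow> 0) (at_right 0)"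
    by (rule real_tendsto_divide_at_top[OF tendsto_const neg_ln_at_right_0])
  then show ?thesis using assms by (rule order_tendstoD)
qed

lemma box_exponent_eventually_bounded:
  fixes F :: "'a::euclidean_space set"
  assumes "bounded F" "F \<noteq> {}"
  shows "eventually (\<lambda>r. 0 \<le> box_exponent F r \<and> box_exponent F r \<le> DIM('a) + 1) (at_right 0)"
proof -
  obtain M where M: "0 \<le> M" "F \<subseteq> cball 0 M" by (rule bounded_subset_cball_0[OF assms(1)])
  define K where "K = (4 * real DIM('a) * M + 3) ^ DIM('a)"
  have K: "0 < K" unfolding K_def using M by (intro zero_less_power) (simp add: add_nonneg_pos)
  show ?thesis
    using eventually_at_right_0[OF zero_less_one] eventually_const_div_neg_ln_less[OF zero_less_one, of "ln K"]
  proof (eventually_elim)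
    case (elim r)
    then have r: "0 < r" "r < 1" by auto
    have ge1: "1 \<le> cover_num r F" by (rule cover_num_ge_1[OF assms r(1)])
    obtain \<U> where \<U>: "scale_cover r F \<U>" "real (card \<U>) \<le> (4 * real DIM('a) * M / r + 3) ^ DIM('a)"
      using grid_cover[OF M(2,1) r(1)] by blast
    have "real (cover_num r F) \<le> real (card \<U>)" using cover_num_le_card[OF \<U>(1)] by simp
    also have "\<dots> \<le> (4 * real DIM('a) * M / r + 3) ^ DIM('a)" by (rule \<U>(2))
    also have "\<dots> \<le> ((4 * real DIM('a) * M + 3) / r) ^ DIM('a)"
      using r M by (intro power_mono) (auto simp: field_simps)
    also have "\<dots> = K * r powr (- real DIM('a))"
      using r by (simp add: K_def power_divide powr_minus_divide powr_realpow)
    finally have "box_exponent F r \<le> DIM('a) + ln K / - ln r"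
      using box_exponent_le ge1 r K by blast
    moreover have "0 \<le> box_exponent F r"
      unfolding box_exponent_def using ge1 r by (intro divide_nonneg_nonneg) auto
    ultimately show ?case using elim by auto
  qed
qed

section \<open>The spectrum and the quasi-Assouad dimension\<close>

text \<open>
  For \<open>R < 1\<close> the power \<open>R powr (1/\<alpha>)\<close> increases with \<open>\<alpha>\<close>, so a larger \<open>\<alpha>\<close> constrains more pairs of
  scales. The side condition \<open>R powr (1/\<beta>) < R\<close> has to be inherited as well, which fails when
  \<open>\<beta> \<ge> 1\<close>: then no pair is constrained at all.
\<close>

lemma upper_Assouad_spectrum_mono:
  assumes "0 < \<alpha>" "\<alpha> \<le> \<beta>" "\<beta> < 1"
  shows "upper_Assouad_spectrum \<alpha> E \<le> upper_Assouad_spectrum \<beta> E"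
  unfolding upper_Assouad_spectrum_def
proof (rule Inf_superset_mono, rule subsetI)
  fix y assume "y \<in> {ereal s | s. \<exists>C>0. \<forall>r R. \<forall>x\<in>E.
       0 < r \<and> r \<le> R powr (1 / \<beta>) \<and> R powr (1 / \<beta>) < R \<and> R < 1 \<longrightarrow>
       real (cover_num r (ball x R \<inter> E)) \<le> C * (R / r) powr s}"
  then obtain s C where s: "y = ereal s" "C > 0" and
    C: "\<And>r R x. x \<in> E \<Longrightarrow> 0 < r \<Longrightarrow> r \<le> R powr (1 / \<beta>) \<Longrightarrow> R powr (1 / \<beta>) < R \<Longrightarrow> R < 1 \<Longrightarrow>
       real (cover_num r (ball x R \<inter> E)) \<le> C * (R / r) powr s" by blast
  have "real (cover_num r (ball x R \<inter> E)) \<le> C * (R / r) powr s"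
    if "x \<in> E" and r: "0 < r" "r \<le> R powr (1 / \<alpha>)" "R powr (1 / \<alpha>) < R" "R < 1" for r R x
  proof -
    have R: "0 < R" using r(3) by (meson less_le_trans not_le powr_ge_zero order.strict_trans1)
    have "1 / \<beta> \<le> 1 / \<alpha>" using assms by (simp add: frac_le)
    then have "R powr (1 / \<alpha>) \<le> R powr (1 / \<beta>)" using R r(4) by (intro powr_mono') auto
    moreover have "R powr (1 / \<beta>) < R powr 1"
      using R r(4) assms by (intro powr_less_mono') auto
    ultimately show ?thesis using R r C[OF that(1)] by simp
  qed
  then show "y \<in> {ereal s | s. \<exists>C>0. \<forall>r R. \<forall>x\<in>E.
       0 < r \<and> r \<le> R powr (1 / \<alpha>) \<and> R powr (1 / \<alpha>) < R \<and> R < 1 \<longrightarrow>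
       real (cover_num r (ball x R \<inter> E)) \<le> C * (R / r) powr s}"
    using s by blast
qed

lemma upper_Assouad_spectrum_le_quasi_Assouad_dim:
  assumes "0 < \<alpha>" "\<alpha> < 1"
  shows "upper_Assouad_spectrum \<alpha> E \<le> quasi_Assouad_dim E"
proof -
  let ?f = "\<lambda>\<alpha>. upper_Assouad_spectrum \<alpha> E"
  have "(?f \<longlongrightarrow> Sup (?f ` ({..<1} \<inter> {0<..<1}))) (at 1 within ({..<1} \<inter> {0<..<1}))"
    by (rule Lim_left_bound[where K = \<infinity>]) (auto intro: upper_Assouad_spectrum_mono)
  moreover have "{..<1} \<inter> {0<..<1} = {0<..<1::real}" by auto
  moreover have "at 1 within {0<..<1} = at_left (1::real)"
    by (rule at_within_nhd[of _ "{0<..}"]) auto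
  ultimately have "(?f \<longlongrightarrow> Sup (?f ` {0<..<1})) (at_left 1)"
    by simp
  then have "quasi_Assouad_dim E = Sup (?f ` {0<..<1})"
    unfolding quasi_Assouad_dim_def by (intro tendsto_Lim) auto
  then show ?thesis using assms by (auto intro: SUP_upper)
qed

section \<open>From theta-covers to covers at a single scale\<close>

lemma filterlim_powr_at_right_0:
  assumes "0 < (a::real)"
  shows "filterlim (\<lambda>x::real. x powr a) (at_right 0) (at_right 0)"
proof -
  have "((\<lambda>x::real. x powr a) \<longlongrightarrow> 0 powr a) (at_right 0)"
    using assms by (intro tendsto_powr') (auto intro: eventually_at_right_less[THEN eventually_mono])
  then show ?thesis
    unfolding filterlim_at
    by (auto intro!: eventually_mono[OF eventually_at_right_less[of "0::real"]])
qed

text \<open>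
  An admissible cover of finite cost is finite, since each of its sets contributes at least
  \<open>\<delta> powr (s/\<theta>) > 0\<close>; the cost is then an ordinary real sum.
\<close>

lemma has_theta_coverE:
  assumes "has_theta_cover \<theta> F s \<epsilon> \<delta>" "0 < \<delta>" "0 \<le> s" "0 \<le> \<epsilon>"
  obtains \<U> where "finite \<U>" "F \<subseteq> \<Union>\<U>"
    "\<And>U. U \<in> \<U> \<Longrightarrow> bounded U" "\<And>U. U \<in> \<U> \<Longrightarrow> \<delta> powr (1 / \<theta>) \<le> diameter U"
    "\<And>U. U \<in> \<U> \<Longrightarrow> diameter U \<le> \<delta>" "(\<Sum>U\<in>\<U>. diameter U powr s) \<le> \<epsilon>"
proof -
  obtain \<U> where \<U>: "F \<subseteq> \<Union>\<U>"
    "\<And>U. U \<in> \<U> \<Longrightarrow> bounded U \<and> \<delta> powr (1 / \<theta>) \<le> diameter U \<and> diameter U \<le> \<delta>"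
    "(\<Sum>\<^sub>\<infinity>U\<in>\<U>. ennreal (diameter U powr s)) \<le> ennreal \<epsilon>"
    using assms(1) unfolding has_theta_cover_def by blast
  have fin: "finite \<U>"
  proof (rule ccontr)
    assume "infinite \<U>"
    then have "(\<Sum>\<^sub>\<infinity>U\<in>\<U>. ennreal (diameter U powr s)) = \<infinity>"
      using \<U>(2) assms(2,3)
      by (intro infsum_superconst_infinite_ennreal[where b = "ennreal ((\<delta> powr (1 / \<theta>)) powr s)"])
         (auto intro!: ennreal_leI powr_mono2)
    then show False using \<U>(3) by (simp add: top_unique)
  qed
  then have "ennreal (\<Sum>U\<in>\<U>. diameter U powr s) \<le> ennreal \<epsilon>"
    using \<U>(3) by (simp add: sum_ennreal)
  then have "(\<Sum>U\<in>\<U>. diameter U powr s) \<le> \<epsilon>"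
    using assms(4) by (simp add: ennreal_le_iff)
  then show ?thesis using that fin \<U>(1,2) by blast
qed

text \<open>
  Each set \<open>U\<close> of the cover that meets \<open>E\<close> lies in a ball of radius \<open>2 |U|\<close> about a point of \<open>E\<close>, and
  the target scale \<open>r = \<delta> powr (2/\<theta>)\<close> is at most \<open>|U|\<^sup>2\<close>. This is the range of the spectrum at \<open>1/2\<close>.
  The factor \<open>\<delta> powr (u - s)\<close> is the gain from weighing the sets with exponent \<open>s\<close>
  instead of \<open>u\<close>. The constant is independent of \<open>\<delta>\<close>, so it will not affect exponents as \<open>\<delta>\<close> tends
  to \<open>0\<close>.
\<close>

lemma cover_num_le_of_theta_cover:
  fixes E :: "'a::euclidean_space set"
  assumes E: "bounded E"
    and u: "upper_Assouad_spectrum (1/2) E < ereal u"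
  shows "\<exists>K>0. \<forall>s \<delta>. 0 \<le> s \<and> s \<le> u \<and> 0 < \<delta> \<and> \<delta> < 1/2 \<and> has_theta_cover \<theta> E s 1 \<delta> \<longrightarrow>
       real (cover_num (\<delta> powr (2/\<theta>)) E) \<le> K * \<delta> powr (u - s) * (\<delta> powr (2/\<theta>)) powr (- u)"
proof -
  obtain s0 C where s0: "s0 < u" "0 < C" and
    C: "\<And>r R x. x \<in> E \<Longrightarrow> 0 < r \<Longrightarrow> r \<le> R powr 2 \<Longrightarrow> R powr 2 < R \<Longrightarrow> R < 1 \<Longrightarrow>
       real (cover_num r (ball x R \<inter> E)) \<le> C * (R / r) powr s0"
    using u unfolding upper_Assouad_spectrum_def Inf_less_iff by fastforce
  have main: "real (cover_num (\<delta> powr (2/\<theta>)) E)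
      \<le> (C * 2 powr u) * \<delta> powr (u - s) * (\<delta> powr (2/\<theta>)) powr (- u)"
    if s: "0 \<le> s" "s \<le> u" and \<delta>: "0 < \<delta>" "\<delta> < 1/2" and cov: "has_theta_cover \<theta> E s 1 \<delta>" for s \<delta>
  proof -
    define r where "r = \<delta> powr (2/\<theta>)"
    have r: "0 < r" "r = (\<delta> powr (1/\<theta>)) powr 2" using \<delta> by (auto simp: r_def powr_powr)
    obtain \<U> where \<U>: "finite \<U>" "E \<subseteq> \<Union>\<U>"
      "\<And>U. U \<in> \<U> \<Longrightarrow> bounded U" "\<And>U. U \<in> \<U> \<Longrightarrow> \<delta> powr (1 / \<theta>) \<le> diameter U"
      "\<And>U. U \<in> \<U> \<Longrightarrow> diameter U \<le> \<delta>" "(\<Sum>U\<in>\<U>. diameter U powr s) \<le> 1"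
      using has_theta_coverE[OF cov \<delta>(1) s(1)] by auto
    have pos: "0 < diameter U" if "U \<in> \<U>" for U
      using \<U>(4)[OF that] \<delta> by (smt (verit) powr_gt_zero)
    have piece: "real (cover_num r (U \<inter> E)) \<le> 
        C * 2 powr u * r powr (- u) * \<delta> powr (u - s) * diameter U powr s" if U: "U \<in> \<U>" for U
    proof (cases "U \<inter> E = {}")
      case True
      have "scale_cover r ({} :: 'a set) {}" by (simp add: scale_cover_def)
      then have "cover_num r (U \<inter> E) = 0" using cover_num_le_card True by fastforce
      then show ?thesis using s0 by simp
    next
      case False
      then obtain x where x: "x \<in> U" "x \<in> E" by auto
      \<comment> \<open>The factor 2 is there because the ball is open: a point of \<open>U\<close> may have distance exactly \<open>|U|\<close> from \<open>x\<close>.\<close>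
      define R where "R = 2 * diameter U"
      have R: "0 < R" "R < 1" "diameter U < R"
        using pos[OF U] \<U>(5)[OF U] \<delta> by (auto simp: R_def)
      have "r \<le> diameter U powr 2" unfolding r(2) using \<U>(4)[OF U] by (intro powr_mono2) auto
      also have "\<dots> \<le> R powr 2" using R pos[OF U] by (intro powr_mono2) auto
      finally have rR: "r \<le> R powr 2" .
      have RR: "R powr 2 < R" using R powr_less_mono'[of R 1 2] by simp
      have sub: "U \<inter> E \<subseteq> ball x R \<inter> E"
        using diameter_bounded_bound[OF \<U>(3)[OF U] x(1)] R(3) by fastforce
      have "cover_num r (U \<inter> E) \<le> (\<Sum>i\<in>{()}. cover_num r (ball x R \<inter> E))"
        using sub r(1) by (intro cover_num_le_sum) auto
      then have "real (cover_num r (U \<inter> E)) \<le> real (cover_num r (ball x R \<inter> E))" by simp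
      also have "\<dots> \<le> C * (R / r) powr s0" by (rule C[OF x(2) r(1) rR RR R(2)])
      also have "\<dots> \<le> C * (R / r) powr u"
        using s0 rR RR r(1) by (intro mult_left_mono powr_mono) auto
      also have "(R / r) powr u = 2 powr u * r powr (- u) * diameter U powr u"
        using r(1) pos[OF U] by (simp add: R_def powr_divide powr_mult powr_minus_divide)
      also have "diameter U powr u = diameter U powr (u - s) * diameter U powr s"
        by (simp add: powr_add[symmetric])
      also have "C * (2 powr u * r powr (- u) * (diameter U powr (u - s) * diameter U powr s)) \<le>
          C * (2 powr u * r powr (- u) * (\<delta> powr (u - s) * diameter U powr s))"
        using s0 s \<U>(5)[OF U] pos[OF U]
        by (intro mult_left_mono mult_right_mono powr_mono2) auto
      finally show ?thesis by (simp add: mult_ac)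
    qed
    have "cover_num r E \<le> (\<Sum>U\<in>\<U>. cover_num r (U \<inter> E))"
      using \<U>(1,2) E r(1) by (intro cover_num_le_sum) auto
    then have "real (cover_num r E) \<le> (\<Sum>U\<in>\<U>. real (cover_num r (U \<inter> E)))"
      by (metis of_nat_le_iff of_nat_sum)
    also have "\<dots> \<le> (\<Sum>U\<in>\<U>. C * 2 powr u * r powr (- u) * \<delta> powr (u - s) * diameter U powr s)"
      by (rule sum_mono[OF piece])
    also have "\<dots> = C * 2 powr u * r powr (- u) * \<delta> powr (u - s) * (\<Sum>U\<in>\<U>. diameter U powr s)"
      by (simp add: sum_distrib_left)
    also have "\<dots> \<le> C * 2 powr u * r powr (- u) * \<delta> powr (u - s)"
      using \<U>(6) s0 by (intro mult_left_le) auto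
    finally show ?thesis by (simp add: r_def mult_ac)
  qed
  show ?thesis by (rule exI[of _ "C * 2 powr u"]) (use main s0 in auto)
qed

text \<open>
  Up to a vanishing error, the exponent provided by the previous lemma is \<open>u - (u - s) \<theta> / 2\<close>.
  At \<open>u = t\<close> it lies below \<open>t\<close> by \<open>(t - s) \<theta> / 2\<close>, that is by \<open>4 e\<close> for the \<open>e\<close> chosen below.
  Of this margin, \<open>2 e\<close> pays for taking \<open>u = t + 2 e\<close> strictly above \<open>t\<close>, and \<open>e\<close> for the constant.
\<close>

lemma box_exponent_le_of_theta_cover:
  fixes E :: "'a::euclidean_space set"
  assumes E: "bounded E" "E \<noteq> {}" and \<theta>: "0 < \<theta>"
    and t: "upper_Assouad_spectrum (1/2) E \<le> ereal t" and s: "0 \<le> s" "s < t"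
  obtains v where "v < t"
    "eventually (\<lambda>\<delta>. has_theta_cover \<theta> E s 1 \<delta> \<longrightarrow> box_exponent E (\<delta> powr (2/\<theta>)) \<le> v) (at_right 0)"
proof -
  define e where "e = (t - s) * \<theta> / 8"
  have e: "0 < e" unfolding e_def using s \<theta> by simp
  define u where "u = t + 2 * e"
  define w where "w = u - (u - s) * (\<theta> / 2)"
  have tu: "upper_Assouad_spectrum (1/2) E < ereal u"
    using t by (rule le_less_trans) (use e in \<open>simp add: u_def\<close>)
  obtain K where K: "0 < K" "\<forall>s \<delta>. 0 \<le> s \<and> s \<le> u \<and> 0 < \<delta> \<and> \<delta> < 1/2 \<and> has_theta_cover \<theta> E s 1 \<delta> \<longrightarrow>
       real (cover_num (\<delta> powr (2/\<theta>)) E) \<le> K * \<delta> powr (u - s) * (\<delta> powr (2/\<theta>)) powr (- u)"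
    using cover_num_le_of_theta_cover[OF E(1) tu] by blast
  have "(t - s) * (\<theta> / 2) \<le> (u - s) * (\<theta> / 2)"
    using e \<theta> by (intro mult_right_mono) (auto simp: u_def)
  then have w: "w \<le> t - 2 * e" by (simp add: w_def u_def e_def mult.commute)
  have "eventually (\<lambda>\<delta>. ln K / - ln (\<delta> powr (2/\<theta>)) < e) (at_right 0)"
    using \<theta> by (intro eventually_compose_filterlim[OF eventually_const_div_neg_ln_less[OF e]
        filterlim_powr_at_right_0]) auto
  moreover have "eventually (\<lambda>\<delta>. 0 < \<delta> \<and> \<delta> < 1/2) (at_right (0::real))"
    by (rule eventually_at_right_0) simp
  ultimately have "eventually (\<lambda>\<delta>. has_theta_cover \<theta> E s 1 \<delta> \<longrightarrow>
      box_exponent E (\<delta> powr (2/\<theta>)) \<le> t - e) (at_right 0)"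
  proof eventually_elim
    case (elim \<delta>)
    show ?case
    proof
      assume cov: "has_theta_cover \<theta> E s 1 \<delta>"
      define r where "r = \<delta> powr (2/\<theta>)"
      have "\<delta> powr (2/\<theta>) < 1 powr (2/\<theta>)" using elim \<theta> by (intro powr_less_mono2) auto
      then have r: "0 < r" "r < 1" using elim by (auto simp: r_def)
      have "\<delta> = r powr (\<theta> / 2)" using elim \<theta> by (simp add: r_def powr_powr)
      then have "\<delta> powr (u - s) * r powr (- u) = r powr (\<theta> / 2 * (u - s) + - u)"
        by (simp only: powr_powr powr_add)
      also have "\<theta> / 2 * (u - s) + - u = - w" by (simp add: w_def)
      finally have "\<delta> powr (u - s) * r powr (- u) = r powr (- w)" .
      moreover have "s \<le> u" using s e by (simp add: u_def)
      ultimately have "real (cover_num r E) \<le> K * r powr (- w)"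
        using K(2)[rule_format, of s \<delta>] s(1) cov elim by (simp add: r_def mult.assoc)
      then have "box_exponent E r \<le> w + ln K / - ln r"
        using box_exponent_le cover_num_ge_1[OF E r(1)] r K(1) by blast
      moreover have "ln K / - ln r < e" using elim by (simp add: r_def)
      ultimately show "box_exponent E (\<delta> powr (2/\<theta>)) \<le> t - e"
        using w by (simp add: r_def[symmetric])
    qed
  qed
  then show ?thesis using that[of "t - e"] e by simp
qed

section \<open>From covers at a single scale to theta-covers\<close>

text \<open>
  A box-counting exponent below \<open>s'\<close> means \<open>N\<^sub>r(E) < r powr (-s')\<close>, so a minimal cover at scale \<open>r\<close>
  costs \<open>N\<^sub>r(E) r\<^sup>s \<le> r powr (s - s')\<close>, which is small for small \<open>r\<close>.
\<close>

lemma has_theta_cover_of_box_exponent: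
  fixes E :: "'a::euclidean_space set"
  assumes E: "bounded E" "E \<noteq> {}" and \<theta>: "0 < \<theta>" "\<theta> \<le> 1" and s: "s' < s" and "0 < \<epsilon>"
  shows "eventually (\<lambda>r. box_exponent E r < s' \<longrightarrow> has_theta_cover \<theta> E s \<epsilon> r) (at_right 0)"
proof -
  have "eventually (\<lambda>r::real. r powr (s - s') < \<epsilon>) (at_right 0)"
    using s assms(6) by (intro eventually_compose_filterlim[OF _ filterlim_powr_at_right_0]
        eventually_mono[OF eventually_at_right_0[of \<epsilon>]]) auto
  moreover have "eventually (\<lambda>r. 0 < r \<and> r < 1) (at_right (0::real))"
    by (rule eventually_at_right_0) simp
  ultimately show ?thesis
  proof eventually_elim
    case (elim r)
    show ?case
    proof
      assume b: "box_exponent E r < s'"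
      have r: "0 < r" "r < 1" using elim by auto
      define N where "N = real (cover_num r E)"
      have N: "1 \<le> N" using cover_num_ge_1[OF E r(1)] by (simp add: N_def)
      have "ln N < - s' * ln r"
        using b r by (simp add: box_exponent_def N_def[symmetric] field_simps)
      also have "\<dots> = ln (r powr (- s'))" using r by (simp add: ln_powr)
      finally have "N < r powr (- s')" using N r by (subst (asm) ln_less_cancel_iff) auto
      then have "N * r powr s \<le> r powr (- s') * r powr s" by (intro mult_right_mono) auto
      also have "\<dots> = r powr (s - s')" by (simp add: powr_add[symmetric])
      finally have le: "N * r powr s \<le> \<epsilon>" using elim by simp
      obtain \<U> where \<U>: "scale_cover r E \<U>" "card \<U> = cover_num r E"
        by (rule cover_num_attained[OF E(1) r(1)])
      have "r powr (1/\<theta>) \<le> r powr 1" using r \<theta> by (intro powr_mono') auto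
      moreover have "(\<Sum>\<^sub>\<infinity>U\<in>\<U>. ennreal (diameter U powr s)) \<le> ennreal \<epsilon>"
      proof -
        have "(\<Sum>\<^sub>\<infinity>U\<in>\<U>. ennreal (diameter U powr s)) = ennreal (\<Sum>U\<in>\<U>. diameter U powr s)"
        proof -
          have "finite \<U>" using \<U>(1) by (simp add: scale_cover_def)
          then show ?thesis by (simp add: sum_ennreal)
        qed
        also have "(\<Sum>U\<in>\<U>. diameter U powr s) = N * r powr s"
          using \<U> by (simp add: scale_cover_def N_def)
        finally show ?thesis using le by (simp add: ennreal_leI)
      qed
      ultimately show "has_theta_cover \<theta> E s \<epsilon> r"
        unfolding has_theta_cover_def using \<U>(1) r by (intro exI[of _ \<U>]) (auto simp: scale_cover_def)
    qed
  qed
qed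

section \<open>Comparison of the dimensions\<close>

text \<open>
  Expressed with filters, the quantifiers over scales in the two intermediate dimensions match those
  of the lower and upper limits in the box dimensions.
\<close>

lemma ex_all_small_iff_eventually:
  "(\<exists>d>0. \<forall>x. 0 < x \<and> x \<le> d \<longrightarrow> P x) \<longleftrightarrow> eventually P (at_right (0::real))"
proof
  assume "eventually P (at_right (0::real))"
  then obtain b where b: "b > 0" "\<And>x. 0 < x \<Longrightarrow> x < b \<Longrightarrow> P x"
    unfolding eventually_at_right_field by auto
  then show "\<exists>d>0. \<forall>x. 0 < x \<and> x \<le> d \<longrightarrow> P x" by (intro exI[of _ "b / 2"]) auto
next
  assume "\<exists>d>0. \<forall>x. 0 < x \<and> x \<le> d \<longrightarrow> P x"
  then obtain d where "d > 0" "\<And>x. 0 < x \<Longrightarrow> x \<le> d \<Longrightarrow> P x" by blast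
  then show "eventually P (at_right (0::real))"
    unfolding eventually_at_right_field by (intro exI[of _ d]) simp
qed

lemma ex_small_iff_frequently:
  "(\<forall>d>0. \<exists>x. 0 < x \<and> x \<le> d \<and> P x) \<longleftrightarrow> frequently P (at_right (0::real))"
  unfolding frequently_def ex_all_small_iff_eventually[symmetric] by blast

lemma lower_box_dim_eq: "lower_box_dim E = Liminf (at_right 0) (\<lambda>r. ereal (box_exponent E r))"
  by (simp add: lower_box_dim_def box_exponent_def)

lemma upper_box_dim_eq: "upper_box_dim E = Limsup (at_right 0) (\<lambda>r. ereal (box_exponent E r))"
  by (simp add: upper_box_dim_def box_exponent_def)

lemma lower_intermediate_dim_eq:
  "lower_intermediate_dim \<theta> E = Inf {ereal s | s. 0 \<le> s \<and>
     (\<forall>\<epsilon>>0. frequently (has_theta_cover \<theta> E s \<epsilon>) (at_right 0))}"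
  by (simp add: lower_intermediate_dim_def ex_small_iff_frequently)

lemma upper_intermediate_dim_eq:
  "upper_intermediate_dim \<theta> E = Inf {ereal s | s. 0 \<le> s \<and>
     (\<forall>\<epsilon>>0. eventually (has_theta_cover \<theta> E s \<epsilon>) (at_right 0))}"
  by (simp add: upper_intermediate_dim_def ex_all_small_iff_eventually)

lemma lower_box_dim_le_upper_box_dim: "lower_box_dim E \<le> upper_box_dim E"
  unfolding lower_box_dim_eq upper_box_dim_eq by (rule Liminf_le_Limsup) simp

lemma lower_box_dim_nonneg:
  fixes E :: "'a::euclidean_space set"
  assumes "bounded E" "E \<noteq> {}"
  shows "0 \<le> lower_box_dim E"
  unfolding lower_box_dim_eq
  by (rule Liminf_bounded)
     (auto intro: eventually_mono[OF box_exponent_eventually_bounded[OF assms]])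

lemma upper_box_dim_less_top:
  fixes E :: "'a::euclidean_space set"
  assumes "bounded E" "E \<noteq> {}"
  shows "upper_box_dim E < \<infinity>"
proof -
  have "upper_box_dim E \<le> ereal (DIM('a) + 1)"
    unfolding upper_box_dim_eq
    by (rule Limsup_bounded)
       (auto intro: eventually_mono[OF box_exponent_eventually_bounded[OF assms]])
  also have "\<dots> < \<infinity>" by simp
  finally show ?thesis .
qed


lemma lower_intermediate_dim_le_lower_box_dim:
  fixes E :: "'a::euclidean_space set"
  assumes E: "bounded E" "E \<noteq> {}" and \<theta>: "0 < \<theta>" "\<theta> \<le> 1"
  shows "lower_intermediate_dim \<theta> E \<le> lower_box_dim E"
proof (rule dense_ge)
  fix x assume "lower_box_dim E < x"
  then obtain s where s: "lower_box_dim E < ereal s" "ereal s < x" using ereal_dense2 by blast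
  then obtain s' where s': "lower_box_dim E < ereal s'" "s' < s" using ereal_dense2 by force
  have "0 \<le> ereal s" using lower_box_dim_nonneg[OF E] s(1) by order
  then have s0: "0 \<le> s" by simp
  have freq: "frequently (\<lambda>r. box_exponent E r < s') (at_right 0)"
  proof (rule ccontr)
    assume "\<not> frequently (\<lambda>r. box_exponent E r < s') (at_right 0)"
    then have "ereal s' \<le> lower_box_dim E"
      unfolding lower_box_dim_eq by (intro Liminf_bounded) (simp add: not_frequently not_less)
    then show False using s'(1) by simp
  qed
  have "frequently (has_theta_cover \<theta> E s \<epsilon>) (at_right 0)" if "0 < \<epsilon>" for \<epsilon>
    by (rule frequently_rev_mp[OF freq has_theta_cover_of_box_exponent[OF E \<theta> s'(2) that]])
  then have "lower_intermediate_dim \<theta> E \<le> ereal s"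
    unfolding lower_intermediate_dim_eq using s0 by (intro Inf_lower) auto
  then show "lower_intermediate_dim \<theta> E \<le> x" using s(2) by order
qed

lemma upper_intermediate_dim_le_upper_box_dim:
  fixes E :: "'a::euclidean_space set"
  assumes E: "bounded E" "E \<noteq> {}" and \<theta>: "0 < \<theta>" "\<theta> \<le> 1"
  shows "upper_intermediate_dim \<theta> E \<le> upper_box_dim E"
proof (rule dense_ge)
  fix x assume "upper_box_dim E < x"
  then obtain s where s: "upper_box_dim E < ereal s" "ereal s < x" using ereal_dense2 by blast
  then obtain s' where s': "upper_box_dim E < ereal s'" "s' < s" using ereal_dense2 by force
  have "0 \<le> ereal s"
    using lower_box_dim_nonneg[OF E] lower_box_dim_le_upper_box_dim[of E] s(1) by order
  then have s0: "0 \<le> s" by simp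
  have ev: "eventually (\<lambda>r. box_exponent E r < s') (at_right 0)"
    using Limsup_lessD[OF s'(1)[unfolded upper_box_dim_eq]] by simp
  have "eventually (has_theta_cover \<theta> E s \<epsilon>) (at_right 0)" if "0 < \<epsilon>" for \<epsilon>
    by (rule eventually_rev_mp[OF ev has_theta_cover_of_box_exponent[OF E \<theta> s'(2) that]])
  then have "upper_intermediate_dim \<theta> E \<le> ereal s"
    unfolding upper_intermediate_dim_eq using s0 by (intro Inf_lower) auto
  then show "upper_intermediate_dim \<theta> E \<le> x" using s(2) by order
qed

text \<open>
  If cheap covers exist at arbitrarily small scales \<open>\<delta>\<close>, the box-counting exponent is at most \<open>v\<close> at
  arbitrarily small scales \<open>\<delta> powr (2/\<theta>)\<close>, against a lower limit \<open>t > v\<close>.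
\<close>

lemma lower_box_dim_le_lower_intermediate_dim:
  fixes E :: "'a::euclidean_space set"
  assumes E: "bounded E" "E \<noteq> {}" and \<theta>: "0 < \<theta>"
    and le: "upper_Assouad_spectrum (1/2) E \<le> lower_box_dim E"
  shows "lower_box_dim E \<le> lower_intermediate_dim \<theta> E"
proof -
  have "lower_box_dim E < \<infinity>"
    using lower_box_dim_le_upper_box_dim upper_box_dim_less_top[OF E] by (rule le_less_trans)
  then obtain t where t: "lower_box_dim E = ereal t"
    using lower_box_dim_nonneg[OF E] by (cases "lower_box_dim E") auto
  have "t \<le> s" if s: "0 \<le> s" and cov: "frequently (has_theta_cover \<theta> E s 1) (at_right 0)" for s
  proof (rule ccontr)
    assume "\<not> t \<le> s"
    then have "s < t" by simp
    from box_exponent_le_of_theta_cover[OF E \<theta> le[unfolded t] s this] obtain v where v: "v < t" and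
      ev: "eventually (\<lambda>\<delta>. has_theta_cover \<theta> E s 1 \<delta> \<longrightarrow> box_exponent E (\<delta> powr (2/\<theta>)) \<le> v)
        (at_right 0)" .
    have "eventually (\<lambda>r. v < box_exponent E r) (at_right 0)"
      using less_LiminfD[of "ereal v" "at_right 0" "\<lambda>r. ereal (box_exponent E r)"] v t
      by (simp add: lower_box_dim_eq)
    then have "eventually (\<lambda>\<delta>. v < box_exponent E (\<delta> powr (2/\<theta>))) (at_right 0)"
      by (rule eventually_compose_filterlim[OF _ filterlim_powr_at_right_0]) (use \<theta> in simp)
    with ev have "eventually (\<lambda>\<delta>. \<not> has_theta_cover \<theta> E s 1 \<delta>) (at_right 0)"
      by eventually_elim auto
    then show False using cov by (simp add: frequently_def)
  qed
  then show ?thesis unfolding t lower_intermediate_dim_eq by (auto intro!: Inf_greatest)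
qed

text \<open>
  The bound on the exponent at the scales \<open>\<delta> powr (2/\<theta>)\<close> is a bound at all small scales, because
  every small \<open>r\<close> is of this form, with \<open>\<delta> = r powr (\<theta>/2)\<close>.
\<close>

lemma upper_box_dim_le_upper_intermediate_dim:
  fixes E :: "'a::euclidean_space set"
  assumes E: "bounded E" "E \<noteq> {}" and \<theta>: "0 < \<theta>"
    and le: "upper_Assouad_spectrum (1/2) E \<le> upper_box_dim E"
  shows "upper_box_dim E \<le> upper_intermediate_dim \<theta> E"
proof -
  have "0 \<le> upper_box_dim E"
    using lower_box_dim_nonneg[OF E] lower_box_dim_le_upper_box_dim by (rule order_trans)
  then obtain t where t: "upper_box_dim E = ereal t"
    using upper_box_dim_less_top[OF E] by (cases "upper_box_dim E") auto
  have "t \<le> s" if s: "0 \<le> s" and cov: "eventually (has_theta_cover \<theta> E s 1) (at_right 0)" for s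
  proof (rule ccontr)
    assume "\<not> t \<le> s"
    then have "s < t" by simp
    from box_exponent_le_of_theta_cover[OF E \<theta> le[unfolded t] s this] obtain v where v: "v < t" and
      ev: "eventually (\<lambda>\<delta>. has_theta_cover \<theta> E s 1 \<delta> \<longrightarrow> box_exponent E (\<delta> powr (2/\<theta>)) \<le> v)
        (at_right 0)" .
    have "eventually (\<lambda>\<delta>. box_exponent E (\<delta> powr (2/\<theta>)) \<le> v) (at_right 0)"
      by (rule eventually_rev_mp[OF cov ev])
    then have "eventually (\<lambda>r. box_exponent E ((r powr (\<theta>/2)) powr (2/\<theta>)) \<le> v) (at_right 0)"
      by (rule eventually_compose_filterlim[OF _ filterlim_powr_at_right_0]) (use \<theta> in simp)
    then have "eventually (\<lambda>r. box_exponent E r \<le> v) (at_right 0)"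
      using eventually_at_right_less[of "0::real"]
      by eventually_elim (use \<theta> in \<open>simp add: powr_powr\<close>)
    then have "upper_box_dim E \<le> ereal v"
      unfolding upper_box_dim_eq by (intro Limsup_bounded) simp
    then show False using v t by simp
  qed
  then show ?thesis unfolding t upper_intermediate_dim_eq by (auto intro!: Inf_greatest)
qed

theorem theorem3p9:
  fixes E :: "'a::euclidean_space set"
  assumes "E \<noteq> {}" and "bounded E"
  shows "(lower_box_dim E = quasi_Assouad_dim E \<longrightarrow>
            (\<forall>\<theta>\<in>{0<..1}. lower_intermediate_dim \<theta> E = lower_box_dim E)) \<and>
         (upper_box_dim E = quasi_Assouad_dim E \<longrightarrow>
            (\<forall>\<theta>\<in>{0<..1}. upper_intermediate_dim \<theta> E = upper_box_dim E))"
proof -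
  note E = assms(2,1)
  have qA: "upper_Assouad_spectrum (1/2) E \<le> quasi_Assouad_dim E"
    by (rule upper_Assouad_spectrum_le_quasi_Assouad_dim) auto
  have "lower_intermediate_dim \<theta> E = lower_box_dim E"
    if "lower_box_dim E = quasi_Assouad_dim E" "\<theta> \<in> {0<..1}" for \<theta>
    using lower_intermediate_dim_le_lower_box_dim[OF E, of \<theta>]
      lower_box_dim_le_lower_intermediate_dim[OF E, of \<theta>] qA that by (intro antisym) auto
  moreover have "upper_intermediate_dim \<theta> E = upper_box_dim E"
    if "upper_box_dim E = quasi_Assouad_dim E" "\<theta> \<in> {0<..1}" for \<theta>
    using upper_intermediate_dim_le_upper_box_dim[OF E, of \<theta>]
      upper_box_dim_le_upper_intermediate_dim[OF E, of \<theta>] qA that by (intro antisym) auto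
  ultimately show ?thesis by blast
qed

end
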